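(* If $G$ is a freely solvable graph and $H$ is a freely neighborhood-solvable graph, then $F(G \,\square\, H) \ge F(G)\,F(H)$.
   Context: Peg solitaire on a graph: a configuration assigns to each vertex either a peg or a hole. If $x,y,z$ form a path $xyz$ with pegs at $x$ and $y$ and a hole at $z$, a jump $xyz$ removes the pegs at $x$ and $y$ and places a peg at $z$. A configuration is solvable if some sequence of jumps reduces it to a single peg. A graph $G$ is freely solvable if, for every vertex $v$, the configuration with a hole only at $v$ (pegs everywhere else) is solvable. A graph $G$ is freely neighborhood-solvable if, for every vertex $v$, the configuration with a hole only at $v$ can be reduced to a single peg located in the closed neighborhood $N[v] = N(v)\cup\{v\}$. A terminal state of $G$ is the set of peg locations when no jump is available, reached by some sequence of jumps from a starting configuration with exactly one hole. The fool's solitaire number $F(G)$ is the maximum size of a terminal state of $G$. The cartesian product $G \,\square\, H$ has vertex set $V(G)\times V(H)$, two vertices being adjacent iff they are equal in one coordinate and adjacent in the other. *)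

theory Defs
  imports "Graph_Theory.Pair_Digraph"
begin

text \<open>
  A finite simple graph is a \<^locale>\<open>pair_graph\<close> (finite, loopfree, symmetric arc set);
  a configuration is identified with its set of pegs.
\<close>

(* x \<noteq> z because only x carries a peg; x \<noteq> y and y \<noteq> z because the graph is loopfree.
   So x, y, z do form a path. *)
definition peg_jump :: "'a pair_pre_digraph \<Rightarrow> 'a set \<Rightarrow> 'a set \<Rightarrow> bool" where
  "peg_jump G S T \<longleftrightarrow>
    (\<exists>x y z. (x, y) \<in> parcs G \<and> (y, z) \<in> parcs G \<and> x \<in> S \<and> y \<in> S \<and> z \<notin> S
      \<and> T = insert z (S - {x, y}))"

abbreviation peg_jumps :: "'a pair_pre_digraph \<Rightarrow> 'a set \<Rightarrow> 'a set \<Rightarrow> bool" where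
  "peg_jumps G \<equiv> (peg_jump G)\<^sup>*\<^sup>*"

definition solvable :: "'a pair_pre_digraph \<Rightarrow> 'a set \<Rightarrow> bool" where
  "solvable G S \<longleftrightarrow> (\<exists>w \<in> pverts G. peg_jumps G S {w})"

definition freely_solvable :: "'a pair_pre_digraph \<Rightarrow> bool" where
  "freely_solvable G \<longleftrightarrow> (\<forall>v \<in> pverts G. solvable G (pverts G - {v}))"

definition closed_nbhd :: "'a pair_pre_digraph \<Rightarrow> 'a \<Rightarrow> 'a set" where
  "closed_nbhd G v = insert v {w. (v, w) \<in> parcs G}"

definition freely_nbhd_solvable :: "'a pair_pre_digraph \<Rightarrow> bool" where
  "freely_nbhd_solvable G \<longleftrightarrow>
    (\<forall>v \<in> pverts G. \<exists>w \<in> closed_nbhd G v. peg_jumps G (pverts G - {v}) {w})"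

definition terminal_state :: "'a pair_pre_digraph \<Rightarrow> 'a set \<Rightarrow> bool" where
  "terminal_state G T \<longleftrightarrow>
    (\<exists>v \<in> pverts G. peg_jumps G (pverts G - {v}) T) \<and> \<not> (\<exists>T'. peg_jump G T T')"

definition fools_solitaire_number :: "'a pair_pre_digraph \<Rightarrow> nat" where
  "fools_solitaire_number G = Max (card ` {T. terminal_state G T})"

definition cartesian_product ::
    "'a pair_pre_digraph \<Rightarrow> 'b pair_pre_digraph \<Rightarrow> ('a \<times> 'b) pair_pre_digraph"
    (infixl "\<box>" 80) where
  "G \<box> H =
    \<lparr> pverts = pverts G \<times> pverts H,
      parcs = {((g, h), (g', h')).
        g \<in> pverts G \<and> g = g' \<and> (h, h') \<in> parcs H \<or>
        h \<in> pverts H \<and> h = h' \<and> (g, g') \<in> parcs G} \<rparr>"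

lemma pair_graph_cartesian_product:
  assumes "pair_graph G" "pair_graph H"
  shows "pair_graph (G \<box> H)"
proof -
  interpret G: pair_graph G by fact
  interpret H: pair_graph H by fact
  have sub: "parcs (G \<box> H) \<subseteq> (pverts G \<times> pverts H) \<times> (pverts G \<times> pverts H)"
    by (auto simp: cartesian_product_def dest: G.wellformed' H.wellformed')
  have fin: "finite (pverts (G \<box> H))"
    using G.pair_finite_verts H.pair_finite_verts by (simp add: cartesian_product_def)
  have "finite (parcs (G \<box> H))"
    using G.pair_finite_verts H.pair_finite_verts
    by (intro finite_subset[OF sub] finite_cartesian_product) auto
  moreover have "symmetric (with_proj (G \<box> H))"
    using G.pair_sym_arcs H.pair_sym_arcs
    by (auto simp: symmetric_def cartesian_product_def intro!: symI dest: symD)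
  moreover have "fst e \<noteq> snd e" if "e \<in> parcs (G \<box> H)" for e
    using that G.pair_no_loops H.pair_no_loops by (fastforce simp: cartesian_product_def)
  moreover have "fst e \<in> pverts (G \<box> H)" "snd e \<in> pverts (G \<box> H)" if "e \<in> parcs (G \<box> H)" for e
    using that by (auto simp: cartesian_product_def dest: G.wellformed' H.wellformed')
  ultimately show ?thesis using fin by unfold_locales
qed

text \<open>
  On a nonempty graph the maximum defining the fool's solitaire number is taken over a
  finite nonempty set.
\<close>

lemma (in pair_graph) peg_jump_subset:
  "peg_jump G S T \<Longrightarrow> S \<subseteq> pverts G \<Longrightarrow> T \<subseteq> pverts G"
  by (auto simp: peg_jump_def dest: wellformed')

lemma (in pair_graph) peg_jumps_subset:
  assumes "peg_jumps G S T" "S \<subseteq> pverts G"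
  shows "T \<subseteq> pverts G"
  using assms by (induction rule: rtranclp_induct) (auto dest: peg_jump_subset)

lemma (in pair_graph) peg_jump_card:
  assumes "peg_jump G S T" "finite S"
  shows "card T < card S"
proof -
  obtain x y z where xyz: "(x, y) \<in> parcs G" "x \<in> S" "y \<in> S" "z \<notin> S"
      "T = insert z (S - {x, y})"
    using assms(1) unfolding peg_jump_def by blast
  have "x \<noteq> y" using pair_no_loops[OF xyz(1)] by simp
  then have "card (S - {x, y}) = card S - 2"
    using xyz by (subst card_Diff_subset) auto
  moreover have "card {x, y} \<le> card S"
    using xyz assms(2) by (intro card_mono) auto
  ultimately show ?thesis
    using xyz assms(2) \<open>x \<noteq> y\<close> by simp
qed

lemma (in pair_graph) finite_terminal_states: "finite {T. terminal_state G T}"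
proof (rule finite_subset)
  show "{T. terminal_state G T} \<subseteq> Pow (pverts G)"
    by (auto simp: terminal_state_def dest!: peg_jumps_subset)
qed (simp add: pair_finite_verts)

lemma (in pair_graph) ex_terminal_state:
  assumes "pverts G \<noteq> {}"
  shows "\<exists>T. terminal_state G T"
proof -
  have *: "\<exists>T. peg_jumps G S T \<and> \<not> (\<exists>T'. peg_jump G T T')" if "S \<subseteq> pverts G" for S
    using that
  proof (induction "card S" arbitrary: S rule: less_induct)
    case less
    show ?case
    proof (cases "\<exists>S'. peg_jump G S S'")
      case True
      then obtain S' where S': "peg_jump G S S'" by blast
      have "finite S" using less.prems pair_finite_verts by (rule finite_subset)
      then obtain T where "peg_jumps G S' T" "\<not> (\<exists>T'. peg_jump G T T')"
        using less.hyps[OF peg_jump_card[OF S'] peg_jump_subset[OF S' less.prems]] by blast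
      then show ?thesis using S' by (meson converse_rtranclp_into_rtranclp)
    qed blast
  qed
  obtain v where "v \<in> pverts G" using assms by blast
  with *[of "pverts G - {v}"] show ?thesis by (auto simp: terminal_state_def)
qed

end

theory Submission
  imports Defs
begin

text \<open>
  Exchanging pegs and holes turns a jump \<open>xyz\<close> into its own inverse, so a state \<open>T\<close> is reachable
  from a single hole at \<open>v\<close> iff its complement reduces to a single peg at \<open>v\<close>.

  Let \<open>T\<close> and \<open>T'\<close> be maximum terminal states of \<open>G\<close> and \<open>H\<close>, reached from holes at \<open>v\<close> and \<open>u\<close>,
  and suppose that \<open>G\<close> has an edge. Then \<open>T \<times> T'\<close> is independent, hence terminal, and its complement
  is reduced as follows. Every row in \<open>T'\<close> is reduced to its peg in column \<open>v\<close>, and then every column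
  other than \<open>v\<close> to its peg in row \<open>u\<close>; this leaves the full column \<open>v\<close> and the full row \<open>u\<close>.
  Let \<open>g\<close> be a neighbour of \<open>v\<close>, and let \<open>f \<in> N[u]\<close> be the last peg for the hole \<open>u\<close> in \<open>H\<close>.
  Two jumps in columns \<open>v\<close> and \<open>g\<close> remove exactly \<open>(g, u)\<close> and \<open>(v, f)\<close>. By duality column \<open>v\<close>
  now reduces to \<open>(v, u)\<close>, and the row \<open>u\<close>, with its only hole at \<open>g\<close>, is solvable.
\<close>

section \<open>Jumps under exchange of pegs and holes\<close>

lemma peg_jumpI:
  assumes "(x, y) \<in> parcs G" "(y, z) \<in> parcs G" "x \<in> S" "y \<in> S" "z \<notin> S"
    and "T = insert z (S - {x, y})"
  shows "peg_jump G S T"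
  unfolding peg_jump_def using assms by blast

lemma (in pair_graph) parcs_sym:
  "(x, y) \<in> parcs G \<Longrightarrow> (y, x) \<in> parcs G"
  using pair_sym_arcs by (simp add: symmetric_def symD)

lemma (in pair_graph) peg_jump_complement:
  assumes "peg_jump G S T" "S \<subseteq> pverts G"
  shows "peg_jump G (pverts G - T) (pverts G - S)"
proof -
  obtain x y z where xyz: "(x, y) \<in> parcs G" "(y, z) \<in> parcs G" "x \<in> S" "y \<in> S" "z \<notin> S"
    and T: "T = insert z (S - {x, y})"
    using assms(1) unfolding peg_jump_def by blast
  have "z \<in> pverts G" using xyz wellformed' by blast
  then have "pverts G - S = insert z (pverts G - T - {x, y})"
    using xyz T assms(2) by blast
  then show ?thesis
    using xyz T assms(2) by (intro peg_jumpI) auto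
qed

lemma (in pair_graph) peg_jumps_complement:
  assumes "peg_jumps G S T" "S \<subseteq> pverts G"
  shows "peg_jumps G (pverts G - T) (pverts G - S)"
  using assms(1)
proof (induction rule: rtranclp_induct)
  case (step T T')
  have "peg_jump G (pverts G - T') (pverts G - T)"
    using step.hyps assms(2) by (intro peg_jump_complement) (auto dest: peg_jumps_subset)
  then show ?case using step.IH by (rule converse_rtranclp_into_rtranclp)
qed blast

lemma (in pair_graph) peg_jumps_complement_singleton:
  assumes "peg_jumps G (pverts G - {v}) T" "v \<in> pverts G"
  shows "peg_jumps G (pverts G - T) {v}"
  using peg_jumps_complement[OF assms(1)] assms(2) by (simp add: double_diff)

section \<open>Playing inside copies of a factor\<close>

text \<open>The pegs in \<open>R\<close> are bystanders: they lie off the embedded copy, so they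
  never occupy a landing hole, and injectivity keeps the landing hole free within the copy.\<close>

lemma peg_jumps_image:
  assumes "inj f" and arcs: "\<And>x y. (x, y) \<in> parcs G \<Longrightarrow> (f x, f y) \<in> parcs K"
    and R: "R \<inter> range f = {}"
    and "peg_jumps G S T"
  shows "peg_jumps K (f ` S \<union> R) (f ` T \<union> R)"
  using assms(4)
proof (induction rule: rtranclp_induct)
  case (step T T')
  obtain x y z where xyz: "(x, y) \<in> parcs G" "(y, z) \<in> parcs G" "x \<in> T" "y \<in> T" "z \<notin> T"
    and T': "T' = insert z (T - {x, y})"
    using step.hyps(2) unfolding peg_jump_def by blast
  have "f ` T' = insert (f z) (f ` T - {f x, f y})"
    using \<open>inj f\<close> by (simp add: T' image_set_diff)
  then have "f ` T' \<union> R = insert (f z) (f ` T \<union> R - {f x, f y})"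
    using R by blast
  moreover have "f z \<notin> f ` T \<union> R"
    using xyz R \<open>inj f\<close> by (auto simp: inj_image_mem_iff)
  ultimately have "peg_jump K (f ` T \<union> R) (f ` T' \<union> R)"
    using xyz arcs by (intro peg_jumpI[of "f x" "f y" _ "f z"]) auto
  with step.IH show ?case by (rule rtranclp.rtrancl_into_rtrancl)
qed blast

lemma peg_jumps_UN_image:
  assumes "finite I" and inj: "\<And>i. i \<in> I \<Longrightarrow> inj (f i)"
    and arcs: "\<And>i x y. i \<in> I \<Longrightarrow> (x, y) \<in> parcs G \<Longrightarrow> (f i x, f i y) \<in> parcs K"
    and disj: "\<And>i j. i \<in> I \<Longrightarrow> j \<in> I \<Longrightarrow> i \<noteq> j \<Longrightarrow> range (f i) \<inter> range (f j) = {}"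
    and R: "\<And>i. i \<in> I \<Longrightarrow> R \<inter> range (f i) = {}"
    and jumps: "peg_jumps G S T"
  shows "peg_jumps K ((\<Union>i\<in>I. f i ` S) \<union> R) ((\<Union>i\<in>I. f i ` T) \<union> R)"
  using \<open>finite I\<close> inj arcs disj R
proof (induction I arbitrary: R)
  case (insert i I)
  \<comment> \<open>Copy \<open>i\<close> is played first, with the untouched copies as bystanders;
    the induction hypothesis then plays the others, with the finished copy \<open>i\<close> moved
    into the bystanders.\<close>
  have "peg_jumps K (f i ` S \<union> ((\<Union>i\<in>I. f i ` S) \<union> R)) (f i ` T \<union> ((\<Union>i\<in>I. f i ` S) \<union> R))"
  proof (rule peg_jumps_image[OF _ _ _ jumps])
    have "range (f j) \<inter> range (f i) = {}" if "j \<in> I" for j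
      using insert.prems(3)[of j i] insert.hyps that by blast
    then show "((\<Union>i\<in>I. f i ` S) \<union> R) \<inter> range (f i) = {}"
      using insert.prems(4)[of i] by blast
  qed (use insert.prems in auto)
  moreover have "peg_jumps K ((\<Union>i\<in>I. f i ` S) \<union> (f i ` T \<union> R)) ((\<Union>i\<in>I. f i ` T) \<union> (f i ` T \<union> R))"
  proof (rule insert.IH)
    fix j assume "j \<in> I"
    then have "range (f i) \<inter> range (f j) = {}" "R \<inter> range (f j) = {}"
      using insert.prems(3)[of i j] insert.prems(4)[of j] insert.hyps by blast+
    then show "(f i ` T \<union> R) \<inter> range (f j) = {}" by blast
  qed (use insert.prems in auto)
  ultimately show ?case by (simp add: Un_ac)
qed simp

lemma parcs_cartesian_product:
  "((g, h), (g', h')) \<in> parcs (G \<box> H) \<longleftrightarrow>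
    g \<in> pverts G \<and> g = g' \<and> (h, h') \<in> parcs H \<or>
    h \<in> pverts H \<and> h = h' \<and> (g, g') \<in> parcs G"
  by (simp add: cartesian_product_def)

lemma pverts_cartesian_product: "pverts (G \<box> H) = pverts G \<times> pverts H"
  by (simp add: cartesian_product_def)

lemma peg_jumps_columns:
  fixes G :: "'a pair_pre_digraph" and H :: "'b pair_pre_digraph"
  assumes "finite A" "A \<subseteq> pverts G" "R \<inter> A \<times> UNIV = {}" "peg_jumps H S T"
  shows "peg_jumps (G \<box> H) (A \<times> S \<union> R) (A \<times> T \<union> R)"
proof -
  have eq: "A \<times> X = (\<Union>a\<in>A. Pair a ` X)" for X :: "'b set" by auto
  show ?thesis
    unfolding eq using assms
    by (intro peg_jumps_UN_image[OF _ _ _ _ _ assms(4)])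
      (auto simp: parcs_cartesian_product inj_on_def)
qed

lemma peg_jumps_rows:
  fixes G :: "'a pair_pre_digraph" and H :: "'b pair_pre_digraph"
  assumes "finite B" "B \<subseteq> pverts H" "R \<inter> UNIV \<times> B = {}" "peg_jumps G S T"
  shows "peg_jumps (G \<box> H) (S \<times> B \<union> R) (T \<times> B \<union> R)"
proof -
  have eq: "X \<times> B = (\<Union>b\<in>B. (\<lambda>a. (a, b)) ` X)" for X :: "'a set" by auto
  show ?thesis
    unfolding eq using assms
    by (intro peg_jumps_UN_image[OF _ _ _ _ _ assms(4)])
      (auto simp: parcs_cartesian_product inj_on_def)
qed

section \<open>Structure of terminal states and of solvable graphs\<close>

lemma (in pair_graph) peg_jumps_card:
  assumes "peg_jumps G S T" "S \<subseteq> pverts G"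
  shows "card T \<le> card S"
  using assms(1)
proof (induction rule: rtranclp_induct)
  case (step T T')
  have "finite T"
    using peg_jumps_subset[OF step.hyps(1) assms(2)] pair_finite_verts by (rule finite_subset)
  with step.hyps(2) have "card T' < card T" by (rule peg_jump_card)
  then show ?case using step.IH by linarith
qed simp

text \<open>The initial hole may get filled, so properness comes from counting: jumps never raise
  the number of pegs.\<close>

lemma (in pair_graph) terminal_state_psubset:
  assumes "terminal_state G T"
  shows "T \<subset> pverts G"
proof -
  obtain v where v: "v \<in> pverts G" and jumps: "peg_jumps G (pverts G - {v}) T"
    using assms unfolding terminal_state_def by blast
  have "card (pverts G - {v}) < card (pverts G)"
    using v by (intro psubset_card_mono) (auto simp: pair_finite_verts)
  then have "card T < card (pverts G)"
    using peg_jumps_card[OF jumps] by simp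
  then show ?thesis using peg_jumps_subset[OF jumps] by auto
qed

text \<open>If a jump \<open>xyz\<close> removed a peg of \<open>C\<close>, closure would put
  \<open>z\<close> in \<open>C\<close>, which is full, but \<open>z\<close> must be a hole.\<close>

lemma peg_jumps_full_closed_set:
  assumes "peg_jumps G S T" "C \<subseteq> S"
    and closed: "\<And>x y. x \<in> C \<Longrightarrow> (x, y) \<in> parcs G \<Longrightarrow> y \<in> C"
  shows "C \<subseteq> T"
  using assms(1,2)
proof (induction rule: rtranclp_induct)
  case (step T T')
  then show ?case using closed unfolding peg_jump_def by blast
qed

text \<open>Let \<open>C\<close> be the pegs with a neighbouring peg. A hole next to a member of
  \<open>C\<close> would allow a jump, so \<open>C\<close> is closed under adjacency. Starting with
  a hole outside \<open>T\<close>, the set \<open>C\<close> stays full forever, yet one peg must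
  remain: \<open>C\<close> has at most one vertex, whereas an edge puts two into it.\<close>

lemma (in pair_graph) terminal_state_independent:
  assumes solv: "\<And>v. v \<in> pverts G \<Longrightarrow> solvable G (pverts G - {v})"
    and T: "terminal_state G T" and "x \<in> T" "y \<in> T"
  shows "(x, y) \<notin> parcs G"
proof
  assume xy: "(x, y) \<in> parcs G"
  define C where "C = {a \<in> T. \<exists>b \<in> T. (a, b) \<in> parcs G}"
  obtain v where v: "v \<in> pverts G" "v \<notin> T"
    using terminal_state_psubset[OF T] by blast
  obtain w where w: "peg_jumps G (pverts G - {v}) {w}"
    using solv[OF v(1)] unfolding solvable_def by blast
  have "C \<subseteq> {w}"
  proof (rule peg_jumps_full_closed_set[OF w])
    show "C \<subseteq> pverts G - {v}"
      using v terminal_state_psubset[OF T] by (auto simp: C_def)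
    fix a b assume a: "a \<in> C" and ab: "(a, b) \<in> parcs G"
    then obtain c where "c \<in> T" "(c, a) \<in> parcs G" using parcs_sym by (auto simp: C_def)
    then have "b \<in> T"
      using T a ab peg_jumpI[of c a G b T] unfolding terminal_state_def C_def by blast
    then show "b \<in> C" using a parcs_sym[OF ab] by (auto simp: C_def)
  qed
  moreover have "x \<in> C" "y \<in> C" using assms xy parcs_sym by (auto simp: C_def)
  ultimately show False using pair_no_loops[OF xy] by auto
qed

text \<open>A new peg on \<open>w\<close> landed there by jumping over a neighbour.\<close>

lemma peg_jumps_into:
  assumes "peg_jumps G S T" "w \<in> T" "w \<notin> S"
  shows "\<exists>y. (y, w) \<in> parcs G"
  using assms
proof (induction rule: rtranclp_induct)
  case (step T T')
  then show ?case unfolding peg_jump_def by blast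
qed blast

lemma peg_jumps_to_singleton:
  assumes "peg_jumps G S {w}" "S \<noteq> {w}"
  shows "\<exists>y. (y, w) \<in> parcs G"
  using assms by (cases rule: rtranclp.cases) (auto simp: peg_jump_def)

text \<open>With the hole at an end \<open>a\<close> of an edge, the peg on an isolated
  \<open>v\<close> can never move, so it must be the last one. The other end \<open>b\<close> is
  pegged too, so at least one jump occurs, and the final jump would have to land on
  \<open>v\<close>.\<close>

lemma (in pair_graph) freely_solvable_no_isolated:
  assumes "freely_solvable G" "parcs G \<noteq> {}" "v \<in> pverts G"
  shows "\<exists>g. (v, g) \<in> parcs G"
proof (rule ccontr)
  assume iso: "\<nexists>g. (v, g) \<in> parcs G"
  obtain a b where ab: "(a, b) \<in> parcs G" using assms(2) by auto
  then have verts: "a \<in> pverts G" "b \<in> pverts G" using wellformed' by auto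
  have "a \<noteq> v" "b \<noteq> v" using iso ab parcs_sym by auto
  have "a \<noteq> b" using pair_no_loops[OF ab] by simp
  obtain w where w: "peg_jumps G (pverts G - {a}) {w}"
    using assms(1) verts unfolding freely_solvable_def solvable_def by blast
  have "{v} \<subseteq> {w}"
    using w by (rule peg_jumps_full_closed_set) (use iso assms(3) \<open>a \<noteq> v\<close> in auto)
  moreover have "pverts G - {a} \<noteq> {v}" using verts \<open>a \<noteq> b\<close> \<open>b \<noteq> v\<close> by blast
  ultimately show False using peg_jumps_to_singleton[OF w] iso parcs_sym by auto
qed

section \<open>Terminal states of the product\<close>

lemma (in pair_graph) obtain_fools_solitaire_number:
  assumes "pverts G \<noteq> {}"
  obtains T where "terminal_state G T" "card T = fools_solitaire_number G"
proof -
  have "fools_solitaire_number G \<in> card ` {T. terminal_state G T}"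
    unfolding fools_solitaire_number_def
    using finite_terminal_states ex_terminal_state[OF assms] by (intro Max_in) auto
  then show thesis using that by auto
qed

lemma (in pair_graph) terminal_state_card_le:
  "terminal_state G T \<Longrightarrow> card T \<le> fools_solitaire_number G"
  unfolding fools_solitaire_number_def
  using finite_terminal_states by (intro Max_ge) auto

text \<open>The product splits into unconnected columns, each a copy of \<open>H\<close>. Only
  column \<open>v\<close> has a hole, so all play happens there.\<close>

lemma terminal_state_product_edgeless:
  assumes H: "pair_graph H"
    and edgeless: "parcs G = {}" and v: "v \<in> pverts G" and T: "terminal_state H T"
  shows "terminal_state (G \<box> H) ({v} \<times> T \<union> (pverts G - {v}) \<times> pverts H)"
proof -
  interpret H: pair_graph H by fact
  obtain u where u: "u \<in> pverts H" and jumps: "peg_jumps H (pverts H - {u}) T"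
    using T unfolding terminal_state_def by blast
  let ?R = "(pverts G - {v}) \<times> pverts H"
  have "peg_jumps (G \<box> H) ({v} \<times> (pverts H - {u}) \<union> ?R) ({v} \<times> T \<union> ?R)"
    by (rule peg_jumps_columns[OF _ _ _ jumps]) (use v in auto)
  moreover have "{v} \<times> (pverts H - {u}) \<union> ?R = pverts (G \<box> H) - {(v, u)}"
    using v by (auto simp: pverts_cartesian_product)
  moreover have "\<not> peg_jump (G \<box> H) ({v} \<times> T \<union> ?R) X" for X
  proof
    assume "peg_jump (G \<box> H) ({v} \<times> T \<union> ?R) X"
    then obtain g x y z where xyz: "(x, y) \<in> parcs H" "(y, z) \<in> parcs H"
      "(g, x) \<in> {v} \<times> T \<union> ?R" "(g, y) \<in> {v} \<times> T \<union> ?R" "(g, z) \<notin> {v} \<times> T \<union> ?R"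
      unfolding peg_jump_def by (auto simp: parcs_cartesian_product edgeless)
    then have "x \<in> T" "y \<in> T" "z \<notin> T" using H.wellformed'(2) by auto
    then show False
      using T xyz(1,2) peg_jumpI[of x y H z T] unfolding terminal_state_def by blast
  qed
  ultimately show ?thesis
    using u v by (auto simp: terminal_state_def pverts_cartesian_product)
qed

text \<open>Both jumps turn a corner of the 4-cycle \<open>{v, g} \<times> {u, w}\<close>, whose
  only hole is \<open>(g, w)\<close>. The first empties its side in column \<open>v\<close> and
  fills its side in column \<open>g\<close>; the second empties the latter and refills one end of
  the former. Its direction selects whether \<open>(v, u)\<close> or \<open>(v, w)\<close> stays a
  hole, which is why \<open>f\<close> must lie in \<open>{u, w}\<close>.\<close>

lemma peg_jumps_cross:
  assumes H: "pair_graph H" and vg: "(v, g) \<in> parcs G" "(g, v) \<in> parcs G"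
    and verts: "v \<in> pverts G" "g \<in> pverts G" "v \<noteq> g"
    and uw: "(u, w) \<in> parcs H" "(w, u) \<in> parcs H" and f: "f \<in> {u, w}"
    and R: "R \<inter> {v, g} \<times> UNIV = {}"
  shows "peg_jumps (G \<box> H) ({v} \<times> pverts H \<union> {(g, u)} \<union> R) ({v} \<times> (pverts H - {f}) \<union> R)"
proof -
  interpret H: pair_graph H by fact
  have uw': "u \<in> pverts H" "w \<in> pverts H" "u \<noteq> w"
    using H.wellformed'[OF uw(1)] H.pair_no_loops[OF uw(1)] by auto
  let ?S = "{v} \<times> (pverts H - {u, w}) \<union> {(g, u), (g, w)} \<union> R"
  have "peg_jump (G \<box> H) ({v} \<times> pverts H \<union> {(g, u)} \<union> R) ?S"
    by (rule peg_jumpI[of "(v, u)" "(v, w)" _ "(g, w)"])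
      (use uw uw' verts vg R in \<open>auto simp: parcs_cartesian_product\<close>)
  moreover have "peg_jump (G \<box> H) ?S ({v} \<times> (pverts H - {f}) \<union> R)"
  proof (cases "f = u")
    case True
    then show ?thesis
      by (intro peg_jumpI[of "(g, u)" "(g, w)" _ "(v, w)"])
        (use uw uw' verts vg R in \<open>auto simp: parcs_cartesian_product\<close>)
  next
    case False
    then have "f = w" using f by blast
    then show ?thesis
      by (intro peg_jumpI[of "(g, w)" "(g, u)" _ "(v, u)"])
        (use uw uw' verts vg R in \<open>auto simp: parcs_cartesian_product\<close>)
  qed
  ultimately show ?thesis by (rule converse_rtranclp_into_rtranclp[OF _ r_into_rtranclp])
qed

lemma terminal_state_product:
  assumes G: "pair_graph G" and H: "pair_graph H"
    and solvG: "freely_solvable G" and solvH: "freely_nbhd_solvable H"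
    and edge: "parcs G \<noteq> {}" and T: "terminal_state G T" and T': "terminal_state H T'"
  shows "terminal_state (G \<box> H) (T \<times> T')"
proof -
  interpret G: pair_graph G by fact
  interpret H: pair_graph H by fact
  interpret GH: pair_graph "G \<box> H" using G H by (rule pair_graph_cartesian_product)
  let ?V = "pverts G" and ?W = "pverts H"
  have sub: "T \<subseteq> ?V" "T' \<subseteq> ?W"
    using G.terminal_state_psubset[OF T] H.terminal_state_psubset[OF T'] by auto
  have "solvable H (?W - {h})" if h: "h \<in> ?W" for h
  proof -
    obtain w where "w \<in> closed_nbhd H h" "peg_jumps H (?W - {h}) {w}"
      using solvH h unfolding freely_nbhd_solvable_def by blast
    then show ?thesis
      using H.peg_jumps_subset[of "?W - {h}" "{w}"] unfolding solvable_def by auto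
  qed
  then have indep: "(x, y) \<notin> parcs G" "(x', y') \<notin> parcs H"
    if "x \<in> T" "y \<in> T" "x' \<in> T'" "y' \<in> T'" for x y x' y'
    using G.terminal_state_independent[OF _ T] H.terminal_state_independent[OF _ T'] that solvG
    unfolding freely_solvable_def by auto
  have stuck: "\<not> peg_jump (G \<box> H) (T \<times> T') X" for X
    using indep by (auto simp: peg_jump_def parcs_cartesian_product)

  obtain v where v: "v \<in> ?V" and redG: "peg_jumps G (?V - {v}) T"
    using T unfolding terminal_state_def by blast
  obtain u where u: "u \<in> ?W" and redH: "peg_jumps H (?W - {u}) T'"
    using T' unfolding terminal_state_def by blast
  obtain g where g: "(v, g) \<in> parcs G"
    using G.freely_solvable_no_isolated[OF solvG edge v] by blast
  have g': "g \<in> ?V" "v \<noteq> g"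
    using G.wellformed'[OF g] G.pair_no_loops[OF g] by auto
  obtain f where f: "f \<in> closed_nbhd H u" and redf: "peg_jumps H (?W - {u}) {f}"
    using solvH u unfolding freely_nbhd_solvable_def by blast
  \<comment> \<open>If \<open>f = u\<close>, any neighbour of \<open>u\<close> serves as
    \<open>w\<close>, and one exists because the initial hole \<open>u\<close> got refilled;
    otherwise \<open>w\<close> is \<open>f\<close> itself.\<close>
  obtain w where w: "(u, w) \<in> parcs H" "f \<in> {u, w}"
  proof (cases "f = u")
    case True
    then have "\<exists>y. (y, u) \<in> parcs H" using redf by (intro peg_jumps_into[of H "?W - {u}"]) auto
    then show thesis using that True H.parcs_sym by blast
  next
    case False
    then show thesis using that f unfolding closed_nbhd_def by auto
  qed
  obtain p where p: "p \<in> ?V" "peg_jumps G (?V - {g}) {p}"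
    using solvG g' unfolding freely_solvable_def solvable_def by blast

  let ?K = "G \<box> H"
  have "peg_jumps ?K (pverts ?K - T \<times> T') ({v} \<times> T' \<union> ?V \<times> (?W - T'))"
  proof -
    have eq: "pverts ?K - T \<times> T' = (?V - T) \<times> T' \<union> ?V \<times> (?W - T')"
      using sub by (auto simp: pverts_cartesian_product)
    show ?thesis
      unfolding eq
      by (rule peg_jumps_rows[OF _ _ _ G.peg_jumps_complement_singleton[OF redG v]])
        (use sub finite_subset[OF sub(2)] in auto)
  qed
  also have "{v} \<times> T' \<union> ?V \<times> (?W - T') = (?V - {v}) \<times> (?W - T') \<union> {v} \<times> ?W"
    using v sub by auto
  also have "peg_jumps ?K \<dots> ((?V - {v}) \<times> {u} \<union> {v} \<times> ?W)"
    by (rule peg_jumps_columns[OF _ _ _ H.peg_jumps_complement_singleton[OF redH u]]) auto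
  also have "(?V - {v}) \<times> {u} \<union> {v} \<times> ?W = {v} \<times> ?W \<union> {(g, u)} \<union> (?V - {v, g}) \<times> {u}"
    using g' by auto
  also have "peg_jumps ?K \<dots> ({v} \<times> (?W - {f}) \<union> (?V - {v, g}) \<times> {u})"
    using H g G.parcs_sym v g' w H.parcs_sym by (intro peg_jumps_cross) auto
  \<comment> \<open>Complementing the play from hole \<open>u\<close> to last peg \<open>f\<close>
    gives a play from hole \<open>f\<close> to last peg \<open>u\<close>.\<close>
  also have "peg_jumps ?K \<dots> ({v} \<times> {u} \<union> (?V - {v, g}) \<times> {u})"
    by (rule peg_jumps_columns[OF _ _ _ H.peg_jumps_complement_singleton[OF redf u]])
      (use v in auto)
  \<comment> \<open>The empty set stands for the bystanders \<open>R\<close> of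
    \<open>peg_jumps_rows\<close>.\<close>
  also have "{v} \<times> {u} \<union> (?V - {v, g}) \<times> {u} = (?V - {g}) \<times> {u} \<union> {}"
    using v g' by auto
  also have "peg_jumps ?K \<dots> ({p} \<times> {u} \<union> {})"
    by (rule peg_jumps_rows[OF _ _ _ p(2)]) (use u in auto)
  finally have "peg_jumps ?K (pverts ?K - T \<times> T') {(p, u)}" by simp
  from GH.peg_jumps_complement[OF this] have "peg_jumps ?K (pverts ?K - {(p, u)}) (T \<times> T')"
    using sub by (auto simp: pverts_cartesian_product double_diff Sigma_mono)
  then show ?thesis
    using stuck p u by (auto simp: terminal_state_def pverts_cartesian_product)
qed

theorem theorem4p1:
  fixes G :: "'a pair_pre_digraph" and H :: "'b pair_pre_digraph"
  assumes "pair_graph G" and "pverts G \<noteq> {}"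
    and "pair_graph H" and "pverts H \<noteq> {}"
    and "freely_solvable G"
    and "freely_nbhd_solvable H"
  shows "fools_solitaire_number (G \<box> H) \<ge>
    fools_solitaire_number G * fools_solitaire_number H"
proof -
  interpret G: pair_graph G by fact
  interpret H: pair_graph H by fact
  interpret GH: pair_graph "G \<box> H" using assms(1,3) by (rule pair_graph_cartesian_product)
  obtain T where T: "terminal_state G T" "card T = fools_solitaire_number G"
    using G.obtain_fools_solitaire_number[OF assms(2)] .
  obtain T' where T': "terminal_state H T'" "card T' = fools_solitaire_number H"
    using H.obtain_fools_solitaire_number[OF assms(4)] .
  show ?thesis
  proof (cases "parcs G = {}")
    case False
    then have "terminal_state (G \<box> H) (T \<times> T')"
      using assms T T' by (intro terminal_state_product) auto
    from GH.terminal_state_card_le[OF this] show ?thesis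
      using T T' by (simp add: card_cartesian_product)
  next
    case True
    \<comment> \<open>No jump passes between columns here, so a different terminal state serves. Its
      full columns alone suffice: there are \<open>card (pverts G) - 1\<close> of them, at least
      \<open>card T\<close>, since \<open>T\<close> is a proper subset.\<close>
    obtain v where v: "v \<in> pverts G" using assms(2) by blast
    let ?X = "{v} \<times> T' \<union> (pverts G - {v}) \<times> pverts H"
    have X: "terminal_state (G \<box> H) ?X"
      using assms True v T' by (intro terminal_state_product_edgeless) auto
    have "card T < card (pverts G)" "card T' \<le> card (pverts H)"
      using G.terminal_state_psubset[OF T(1)] H.terminal_state_psubset[OF T'(1)]
      by (auto intro: psubset_card_mono card_mono)
    then have "card T * card T' \<le> card ((pverts G - {v}) \<times> pverts H)"
      using v by (auto simp: card_cartesian_product intro!: mult_mono)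
    also have "\<dots> \<le> card ?X"
      using GH.terminal_state_psubset[OF X] finite_subset[OF _ GH.pair_finite_verts]
      by (intro card_mono) auto
    also have "\<dots> \<le> fools_solitaire_number (G \<box> H)"
      using X by (rule GH.terminal_state_card_le)
    finally show ?thesis using T T' by simp
  qed
qed

end
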